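(* Let $A$ be a complex Banach space, let $\varphi\in A^*$ be non-zero with $\|\varphi\|\le 1$, and let ${}_\varphi A$ denote $A$ with the Banach algebra product $a\cdot b=\langle\varphi,a\rangle b$. A subspace $I$ of ${}_\varphi A$ is a modular left ideal if and only if either $I={}_\varphi A$ or $I=\ker\varphi$. In particular, $\ker\varphi$ is the unique primitive ideal in ${}_\varphi A$, and this implies that $\operatorname{rad}({}_\varphi A)=\ker\varphi$ and so ${}_\varphi A$ is not semi-simple. Furthermore, for every non-zero proper closed ideal $I$ of ${}_\varphi A$, $\operatorname{rad}(I)=I\cap\operatorname{rad}({}_\varphi A)=I\cap\ker\varphi=I$.
   Context: A left ideal $I$ of an algebra $B$ is modular if there is $u\in B$ with $b-bu\in I$ for all $b\in B$ (the case $I=B$ is allowed). A primitive ideal is the kernel of an algebraically irreducible (non-zero) representation of $B$, i.e. the annihilator of a simple left $B$-module. $\operatorname{rad}(B)$ is the Jacobson radical of $B$ (the intersection of all primitive ideals, equal to $B$ if there are none); $B$ is semi-simple if $\operatorname{rad}(B)=\{0\}$. "Ideal" means two-sided ideal; $\operatorname{rad}(I)$ is the Jacobson radical of $I$ viewed as an algebra in its own right.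
   Formalization: The claim that the algebra is not semi-simple is stated only when A is not one-dimensional; for one-dimensional A (e.g. A = C, φ = id) ker φ = {0} and the algebra is semi-simple, so the claim fails there. *)

theory Defs
  imports "HOL-Analysis.Analysis"
begin

section \<open>Complex Banach spaces\<close>

class complex_vector = real_vector +
  fixes scaleC :: "complex \<Rightarrow> 'a \<Rightarrow> 'a"  (infixr \<open>*\<^sub>C\<close> 75)
  assumes scaleC_add_right: "a *\<^sub>C (x + y) = a *\<^sub>C x + a *\<^sub>C y"
    and scaleC_add_left: "(a + b) *\<^sub>C x = a *\<^sub>C x + b *\<^sub>C x"
    and scaleC_scaleC: "a *\<^sub>C b *\<^sub>C x = (a * b) *\<^sub>C x"
    and scaleC_one: "1 *\<^sub>C x = x"
    and scaleR_scaleC: "r *\<^sub>R x = complex_of_real r *\<^sub>C x"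

class complex_banach = complex_vector + banach +
  assumes norm_scaleC: "norm (a *\<^sub>C x) = cmod a * norm x"

instantiation complex :: complex_banach
begin

definition scaleC_complex :: "complex \<Rightarrow> complex \<Rightarrow> complex"
  where "scaleC_complex a x = a * x"

instance
  by standard (simp_all add: scaleC_complex_def algebra_simps norm_mult scaleR_conv_of_real)

end

global_interpretation complex_vector: vector_space "scaleC :: complex \<Rightarrow> 'a \<Rightarrow> 'a::complex_vector"
  by unfold_locales (rule scaleC_add_right scaleC_add_left scaleC_scaleC scaleC_one)+

abbreviation csubspace :: "'a::complex_vector set \<Rightarrow> bool"
  where "csubspace \<equiv> complex_vector.subspace"

definition bounded_functional :: "('a::complex_banach \<Rightarrow> complex) \<Rightarrow> bool"
  where "bounded_functional f \<longleftrightarrow> bounded_linear f \<and> (\<forall>c x. f (c *\<^sub>C x) = c * f x)"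


section \<open>Ideals and the Jacobson radical\<close>

text \<open>
  An algebra is given by its carrier \<open>B\<close>, a complex subspace of a type, and a product on that type
  (only its values on \<open>B\<close> matter), so that a subalgebra, in particular an ideal, can be regarded
  as an algebra in its own right by changing the carrier.
\<close>

definition left_ideal :: "'a::complex_vector set \<Rightarrow> ('a \<Rightarrow> 'a \<Rightarrow> 'a) \<Rightarrow> 'a set \<Rightarrow> bool"
  where "left_ideal B mul I \<longleftrightarrow>
    csubspace I \<and> I \<subseteq> B \<and> (\<forall>b\<in>B. \<forall>x\<in>I. mul b x \<in> I)"

definition modular_left_ideal :: "'a::complex_vector set \<Rightarrow> ('a \<Rightarrow> 'a \<Rightarrow> 'a) \<Rightarrow> 'a set \<Rightarrow> bool"
  where "modular_left_ideal B mul I \<longleftrightarrow>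
    left_ideal B mul I \<and> (\<exists>u\<in>B. \<forall>b\<in>B. b - mul b u \<in> I)"

definition two_sided_ideal :: "'a::complex_vector set \<Rightarrow> ('a \<Rightarrow> 'a \<Rightarrow> 'a) \<Rightarrow> 'a set \<Rightarrow> bool"
  where "two_sided_ideal B mul I \<longleftrightarrow>
    left_ideal B mul I \<and> (\<forall>b\<in>B. \<forall>x\<in>I. mul x b \<in> I)"

definition representation ::
    "'a::complex_vector set \<Rightarrow> ('a \<Rightarrow> 'a \<Rightarrow> 'a) \<Rightarrow> 'm::complex_vector set \<Rightarrow> ('a \<Rightarrow> 'm \<Rightarrow> 'm) \<Rightarrow> bool"
  where "representation B mul E \<pi> \<longleftrightarrow>
    csubspace E \<and>
    (\<forall>b\<in>B. \<forall>x\<in>E. \<pi> b x \<in> E) \<and>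
    (\<forall>b\<in>B. \<forall>x\<in>E. \<forall>y\<in>E. \<pi> b (x + y) = \<pi> b x + \<pi> b y) \<and>
    (\<forall>b\<in>B. \<forall>c. \<forall>x\<in>E. \<pi> b (c *\<^sub>C x) = c *\<^sub>C \<pi> b x) \<and>
    (\<forall>a\<in>B. \<forall>b\<in>B. \<forall>x\<in>E. \<pi> (a + b) x = \<pi> a x + \<pi> b x) \<and>
    (\<forall>c. \<forall>b\<in>B. \<forall>x\<in>E. \<pi> (c *\<^sub>C b) x = c *\<^sub>C \<pi> b x) \<and>
    (\<forall>a\<in>B. \<forall>b\<in>B. \<forall>x\<in>E. \<pi> (mul a b) x = \<pi> a (\<pi> b x))"

text \<open>Non-zero means that the action is non-zero, which is more than \<open>E \<noteq> {0}\<close>.\<close>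

definition irreducible_representation ::
    "'a::complex_vector set \<Rightarrow> ('a \<Rightarrow> 'a \<Rightarrow> 'a) \<Rightarrow> 'm::complex_vector set \<Rightarrow> ('a \<Rightarrow> 'm \<Rightarrow> 'm) \<Rightarrow> bool"
  where "irreducible_representation B mul E \<pi> \<longleftrightarrow>
    representation B mul E \<pi> \<and>
    (\<exists>b\<in>B. \<exists>x\<in>E. \<pi> b x \<noteq> 0) \<and>
    (\<forall>F. csubspace F \<and> F \<subseteq> E \<and> (\<forall>b\<in>B. \<forall>x\<in>F. \<pi> b x \<in> F) \<longrightarrow> F = {0} \<or> F = E)"

definition representation_kernel :: "'a set \<Rightarrow> 'm::zero set \<Rightarrow> ('a \<Rightarrow> 'm \<Rightarrow> 'm) \<Rightarrow> 'a set"
  where "representation_kernel B E \<pi> = {b \<in> B. \<forall>x\<in>E. \<pi> b x = 0}"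

text \<open>
  HOL cannot quantify over the type of the module inside a definition. Modules whose underlying
  vector space is a subspace of the type of the algebra suffice: a simple module is
  isomorphic to \<open>B/L\<close> for a left ideal \<open>L\<close>, hence, as a vector space, to a complement of \<open>L\<close>
  in \<open>B\<close>. The lemma \<open>irreducible_representation_kernel_primitive\<close> below makes this precise.
\<close>

definition primitive_ideal :: "'a::complex_vector set \<Rightarrow> ('a \<Rightarrow> 'a \<Rightarrow> 'a) \<Rightarrow> 'a set \<Rightarrow> bool"
  where "primitive_ideal B mul P \<longleftrightarrow>
    (\<exists>(E :: 'a set) \<pi>. irreducible_representation B mul E \<pi> \<and> P = representation_kernel B E \<pi>)"

lemma irreducible_representation_kernel_primitive:
  fixes B :: "'a::complex_vector set" and E :: "'m::complex_vector set"
  assumes B: "csubspace B" and mul: "\<And>a b. a \<in> B \<Longrightarrow> b \<in> B \<Longrightarrow> mul a b \<in> B"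
    and irr: "irreducible_representation B mul E \<pi>"
  shows "primitive_ideal B mul (representation_kernel B E \<pi>)"
proof -
  interpret vector_space_pair "scaleC :: complex \<Rightarrow> 'm \<Rightarrow> 'm" "scaleC :: complex \<Rightarrow> 'a \<Rightarrow> 'a" ..
  have E: "csubspace E"
    and cl: "\<And>b x. b \<in> B \<Longrightarrow> x \<in> E \<Longrightarrow> \<pi> b x \<in> E"
    and add2: "\<And>b x y. b \<in> B \<Longrightarrow> x \<in> E \<Longrightarrow> y \<in> E \<Longrightarrow> \<pi> b (x + y) = \<pi> b x + \<pi> b y"
    and sc2: "\<And>b c x. b \<in> B \<Longrightarrow> x \<in> E \<Longrightarrow> \<pi> b (c *\<^sub>C x) = c *\<^sub>C \<pi> b x"
    and add1: "\<And>a b x. a \<in> B \<Longrightarrow> b \<in> B \<Longrightarrow> x \<in> E \<Longrightarrow> \<pi> (a + b) x = \<pi> a x + \<pi> b x"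
    and sc1: "\<And>c b x. b \<in> B \<Longrightarrow> x \<in> E \<Longrightarrow> \<pi> (c *\<^sub>C b) x = c *\<^sub>C \<pi> b x"
    and mu: "\<And>a b x. a \<in> B \<Longrightarrow> b \<in> B \<Longrightarrow> x \<in> E \<Longrightarrow> \<pi> (mul a b) x = \<pi> a (\<pi> b x)"
    using irr unfolding irreducible_representation_def representation_def by blast+
  have inv: "\<And>F. csubspace F \<Longrightarrow> F \<subseteq> E \<Longrightarrow> (\<And>b x. b \<in> B \<Longrightarrow> x \<in> F \<Longrightarrow> \<pi> b x \<in> F) \<Longrightarrow> F = {0} \<or> F = E"
    using irr unfolding irreducible_representation_def by blast
  obtain b0 x where b0: "b0 \<in> B" and x: "x \<in> E" and nz: "\<pi> b0 x \<noteq> 0"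
    using irr unfolding irreducible_representation_def by blast
  have "(\<lambda>b. \<pi> b x) ` B = {0} \<or> (\<lambda>b. \<pi> b x) ` B = E"
  proof (rule inv)
    show "csubspace ((\<lambda>b. \<pi> b x) ` B)"
      unfolding complex_vector.subspace_def
    proof (intro conjI ballI allI)
      show "0 \<in> (\<lambda>b. \<pi> b x) ` B"
        using sc1[OF b0 x, of 0] complex_vector.subspace_0[OF B] by (metis complex_vector.scale_zero_left imageI)
    next
      fix y z assume "y \<in> (\<lambda>b. \<pi> b x) ` B" "z \<in> (\<lambda>b. \<pi> b x) ` B"
      then show "y + z \<in> (\<lambda>b. \<pi> b x) ` B"
        using add1[OF _ _ x] complex_vector.subspace_add[OF B] by (smt (verit) image_iff)
    next
      fix c y assume "y \<in> (\<lambda>b. \<pi> b x) ` B"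
      then show "c *\<^sub>C y \<in> (\<lambda>b. \<pi> b x) ` B"
        using sc1[OF _ x] complex_vector.subspace_scale[OF B] by (smt (verit) image_iff)
    qed
    show "(\<lambda>b. \<pi> b x) ` B \<subseteq> E" using cl x by blast
    show "\<pi> b y \<in> (\<lambda>b. \<pi> b x) ` B" if "b \<in> B" "y \<in> (\<lambda>b. \<pi> b x) ` B" for b y
      using that mu[OF _ _ x] mul by (smt (verit) image_iff)
  qed
  then have surj: "(\<lambda>b. \<pi> b x) ` B = E" using nz b0 by blast
  obtain S where S: "S \<subseteq> E" "complex_vector.independent S" "E \<subseteq> complex_vector.span S"
    using complex_vector.basis_exists by metis
  define h where "h s = (SOME b. b \<in> B \<and> \<pi> b x = s)" for s
  have h: "h s \<in> B \<and> \<pi> (h s) x = s" if "s \<in> E" for s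
    unfolding h_def by (rule someI_ex) (use surj that in blast)
  define g where "g = construct S h"
  have lin: "Vector_Spaces.linear scaleC scaleC g"
    unfolding g_def by (rule linear_construct[OF S(2)])
  have gadd: "g (y + z) = g y + g z" and gsc: "g (c *\<^sub>C y) = c *\<^sub>C g y" for y z c
    using linear_add[OF lin] linear_scale[OF lin] by blast+
  have g0: "g 0 = 0" using linear_0[OF lin] .
  have gS: "g s = h s" if "s \<in> S" for s
    unfolding g_def using construct_basis[OF S(2) that] .
  have zero: "\<pi> 0 y = 0" if "y \<in> E" for y
    using sc1[OF b0 that, of 0] by simp
  have gE0: "g y \<in> B \<and> \<pi> (g y) x = y" if "y \<in> complex_vector.span S" for y
    using that
  proof (induction rule: complex_vector.span_induct_alt)
    case base
    show ?case using g0 complex_vector.subspace_0[OF B] zero x by simp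
  next
    case (step c s y)
    then have s: "g s \<in> B" "\<pi> (g s) x = s" using gS h S by auto
    then show ?case
      using step complex_vector.subspace_scale[OF B] complex_vector.subspace_add[OF B]
      by (simp add: gadd gsc add1 sc1 x)
  qed
  have gB: "g y \<in> B" and gp: "\<pi> (g y) x = y" if "y \<in> E" for y
    using gE0 S(3) that by blast+
  define \<rho> where "\<rho> b w = g (\<pi> b (\<pi> w x))" for b w
  have rho: "\<rho> b (g y) = g (\<pi> b y)" if "y \<in> E" for b y
    using gp[OF that] by (simp add: \<rho>_def)
  have subg: "csubspace (g ` F)" if "csubspace F" for F
    using linear_subspace_image[OF lin that] .
  have "representation B mul (g ` E) \<rho>"
    unfolding representation_def ball_simps
    using E cl by (auto simp: subg rho add1 add2 sc1 sc2 mu complex_vector.subspace_add complex_vector.subspace_scale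
        simp flip: gadd gsc)
  moreover have "\<exists>b\<in>B. \<exists>w\<in>g ` E. \<rho> b w \<noteq> 0"
  proof (intro bexI)
    show "\<rho> b0 (g x) \<noteq> 0"
      using nz rho[OF x] gp[OF cl[OF b0 x]] zero[OF x] by metis
  qed (use b0 x in auto)
  moreover have "F = {0} \<or> F = g ` E"
    if F: "csubspace F" "F \<subseteq> g ` E" "\<forall>b\<in>B. \<forall>w\<in>F. \<rho> b w \<in> F" for F
  proof -
    define G where "G = {y \<in> E. g y \<in> F}"
    have FG: "F = g ` G" using F(2) by (auto simp: G_def)
    have "G = {0} \<or> G = E"
    proof (rule inv)
      show "csubspace G"
        using E F(1) unfolding G_def complex_vector.subspace_def by (auto simp: g0 gadd gsc)
      show "G \<subseteq> E" by (auto simp: G_def)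
      show "\<pi> b y \<in> G" if "b \<in> B" "y \<in> G" for b y
      proof -
        have y: "y \<in> E" "g y \<in> F" using that(2) by (auto simp: G_def)
        then have "g (\<pi> b y) \<in> F" using F(3) that(1) rho[OF y(1), of b] by metis
        then show ?thesis using cl[OF that(1) y(1)] by (simp add: G_def)
      qed
    qed
    then show ?thesis using FG g0 by auto
  qed
  ultimately have "irreducible_representation B mul (g ` E) \<rho>"
    unfolding irreducible_representation_def by blast
  moreover have "representation_kernel B E \<pi> = representation_kernel B (g ` E) \<rho>"
  proof -
    have "\<pi> b y = 0 \<longleftrightarrow> g (\<pi> b y) = 0" if "b \<in> B" "y \<in> E" for b y
      using gp[OF cl[OF that]] g0 zero[OF x] by metis
    then show ?thesis unfolding representation_kernel_def by (auto simp: rho)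
  qed
  ultimately show ?thesis unfolding primitive_ideal_def by blast
qed

text \<open>Every primitive ideal of \<open>B\<close> is contained in \<open>B\<close>; if there are none, the radical is \<open>B\<close>.\<close>

definition rad :: "'a::complex_vector set \<Rightarrow> ('a \<Rightarrow> 'a \<Rightarrow> 'a) \<Rightarrow> 'a set"
  where "rad B mul = B \<inter> \<Inter>{P. primitive_ideal B mul P}"

definition semi_simple :: "'a::complex_vector set \<Rightarrow> ('a \<Rightarrow> 'a \<Rightarrow> 'a) \<Rightarrow> bool"
  where "semi_simple B mul \<longleftrightarrow> rad B mul = {0}"


section \<open>The product induced by a functional\<close>

definition functional_mult :: "('a::complex_vector \<Rightarrow> complex) \<Rightarrow> 'a \<Rightarrow> 'a \<Rightarrow> 'a"
  where "functional_mult \<phi> a b = \<phi> a *\<^sub>C b"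

lemma functional_mult_banach_algebra:
  assumes "bounded_functional \<phi>" "onorm \<phi> \<le> 1"
  shows "functional_mult \<phi> (functional_mult \<phi> a b) c = functional_mult \<phi> a (functional_mult \<phi> b c)"
    and "functional_mult \<phi> (a + b) c = functional_mult \<phi> a c + functional_mult \<phi> b c"
    and "functional_mult \<phi> a (b + c) = functional_mult \<phi> a b + functional_mult \<phi> a c"
    and "functional_mult \<phi> (z *\<^sub>C a) b = z *\<^sub>C functional_mult \<phi> a b"
    and "functional_mult \<phi> a (z *\<^sub>C b) = z *\<^sub>C functional_mult \<phi> a b"
    and "norm (functional_mult \<phi> a b) \<le> norm a * norm b"
proof -
  have bl: "bounded_linear \<phi>" and sc: "\<And>c x. \<phi> (c *\<^sub>C x) = c * \<phi> x"
    using assms(1) by (auto simp: bounded_functional_def)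
  show "functional_mult \<phi> (functional_mult \<phi> a b) c = functional_mult \<phi> a (functional_mult \<phi> b c)"
    and "functional_mult \<phi> (z *\<^sub>C a) b = z *\<^sub>C functional_mult \<phi> a b"
    and "functional_mult \<phi> a (z *\<^sub>C b) = z *\<^sub>C functional_mult \<phi> a b"
    and "functional_mult \<phi> a (b + c) = functional_mult \<phi> a b + functional_mult \<phi> a c"
    by (simp_all add: functional_mult_def sc mult.commute complex_vector.scale_right_distrib)
  show "functional_mult \<phi> (a + b) c = functional_mult \<phi> a c + functional_mult \<phi> b c"
    using linear_add[OF bounded_linear.linear[OF bl]]
    by (simp add: functional_mult_def complex_vector.scale_left_distrib)
  have "cmod (\<phi> a) \<le> 1 * norm a"
    using onorm[OF bl, of a] mult_right_mono[OF assms(2) norm_ge_zero[of a]] by linarith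
  then show "norm (functional_mult \<phi> a b) \<le> norm a * norm b"
    by (simp add: functional_mult_def norm_scaleC mult_right_mono)
qed

text \<open>
  If the space is one-dimensional, then the kernel of a non-zero functional is \<open>{0}\<close> and the algebra
  is semi-simple; non-semi-simplicity is meant for \<open>complex_vector.dim UNIV \<noteq> 1\<close>. The function
  \<open>complex_vector.dim\<close> takes the value \<open>0\<close> on infinite-dimensional spaces.
\<close>

end

(* An element a of B with aB = 0 acts as zero in every irreducible representation: the null space
   of its action is invariant and contains everything of the form bx. In the algebra with product
   \<phi>(a)b this applies to every a in the kernel of \<phi>; since this kernel is a hyperplane, it is
   the kernel of every irreducible representation. A proper ideal lies in the kernel of \<phi>, so it
   has zero product and no irreducible representations at all. *)
theory Submission
  imports Defs
begin

text \<open>If \<phi> v is non-zero for some v in \<open>I\<close>, every x differs from a multiple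
  of v by a vector killed by \<phi>, so x lies in \<open>I\<close>.\<close>

lemma hyperplane_maximal:
  fixes \<phi> :: "'a::complex_banach \<Rightarrow> complex"
  assumes \<phi>: "bounded_functional \<phi>" and I: "csubspace I" and ker: "{x. \<phi> x = 0} \<subseteq> I"
  shows "I = UNIV \<or> I = {x. \<phi> x = 0}"
proof (rule disjCI)
  assume "I \<noteq> {x. \<phi> x = 0}"
  then obtain v where v: "v \<in> I" "\<phi> v \<noteq> 0" using ker by blast
  have "x \<in> I" for x
  proof -
    have "\<phi> (x - (\<phi> x / \<phi> v) *\<^sub>C v) = 0"
      using \<phi> v by (simp add: bounded_functional_def bounded_linear.linear linear_diff)
    then have "x - (\<phi> x / \<phi> v) *\<^sub>C v \<in> I" using ker by blast
    moreover have "(\<phi> x / \<phi> v) *\<^sub>C v \<in> I"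
      using I v by (simp add: complex_vector.subspace_scale)
    ultimately show ?thesis
      using complex_vector.subspace_add[OF I] by fastforce
  qed
  then show "I = UNIV" by blast
qed

lemma functional_normalized_vector:
  assumes "bounded_functional \<phi>" "\<phi> \<noteq> (\<lambda>_. 0)"
  obtains u where "\<phi> u = 1"
proof -
  obtain v where "\<phi> v \<noteq> 0" using assms(2) by blast
  then have "\<phi> ((1 / \<phi> v) *\<^sub>C v) = 1"
    using assms(1) by (simp add: bounded_functional_def)
  then show thesis by (rule that)
qed

text \<open>Left multiplication by b is the scalar \<phi> b, and subspaces are stable under
  scalars.\<close>

lemma left_ideal_functional_mult:
  "csubspace I \<Longrightarrow> left_ideal UNIV (functional_mult \<phi>) I"
  by (simp add: left_ideal_def functional_mult_def complex_vector.subspace_scale)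

lemma modular_left_ideal_functional_mult_iff:
  assumes \<phi>: "bounded_functional \<phi>" "\<phi> \<noteq> (\<lambda>_. 0)" and I: "csubspace I"
  shows "modular_left_ideal UNIV (functional_mult \<phi>) I \<longleftrightarrow> I = UNIV \<or> I = {x. \<phi> x = 0}"
proof
  assume "modular_left_ideal UNIV (functional_mult \<phi>) I"
  then obtain u where u: "\<And>b. b - \<phi> b *\<^sub>C u \<in> I"
    by (auto simp: modular_left_ideal_def functional_mult_def)
  \<comment> \<open>When \<phi> x = 0, the modularity condition for x reads x - 0 \<in>
    \<open>I\<close>.\<close>
  have "{x. \<phi> x = 0} \<subseteq> I"
  proof
    fix x assume "x \<in> {x. \<phi> x = 0}"
    then show "x \<in> I" using u[of x] by simp
  qed
  then show "I = UNIV \<or> I = {x. \<phi> x = 0}" by (rule hyperplane_maximal[OF \<phi>(1) I])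
next
  assume *: "I = UNIV \<or> I = {x. \<phi> x = 0}"
  \<comment> \<open>Such a u is a right unit modulo the kernel: \<phi> sends b - \<phi>(b)u to
    \<phi> b - \<phi> b = 0.\<close>
  obtain u where "\<phi> u = 1" using functional_normalized_vector[OF \<phi>] .
  then have "b - \<phi> b *\<^sub>C u \<in> I" for b
    using * \<phi>(1) by (auto simp: bounded_functional_def bounded_linear.linear linear_diff)
  then show "modular_left_ideal UNIV (functional_mult \<phi>) I"
    using left_ideal_functional_mult[OF I] by (auto simp: modular_left_ideal_def functional_mult_def)
qed

lemma representation_zero:
  assumes rep: "representation B mul E \<pi>" and B: "csubspace B" and x: "x \<in> E"
  shows "\<pi> 0 x = 0"
proof -
  have "\<pi> (0 *\<^sub>C 0) x = 0 *\<^sub>C \<pi> 0 x"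
    using rep complex_vector.subspace_0[OF B] x unfolding representation_def by blast
  then show ?thesis by simp
qed

lemma subspace_representation_kernel:
  assumes rep: "representation B mul E \<pi>" and B: "csubspace B"
  shows "csubspace (representation_kernel B E \<pi>)"
  using rep B representation_zero[OF rep B]
  by (auto simp: representation_kernel_def representation_def complex_vector.subspace_def)

lemma irreducible_representation_left_annihilator:
  assumes irr: "irreducible_representation B mul E \<pi>" and B: "csubspace B"
    and a: "a \<in> B" "\<And>b. b \<in> B \<Longrightarrow> mul a b = 0"
  shows "a \<in> representation_kernel B E \<pi>"
proof -
  have rep: "representation B mul E \<pi>"
    using irr by (simp add: irreducible_representation_def)
  define N where "N = {x \<in> E. \<pi> a x = 0}"
  \<comment> \<open>Here x ranges over all of \<open>E\<close>. This is stronger than invariance of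
    \<open>N\<close>, and the excess is what later rules out \<open>N = {0}\<close>.\<close>
  have N: "\<pi> b x \<in> N" if "b \<in> B" "x \<in> E" for b x
  proof -
    have "\<pi> b x \<in> E" "\<pi> (mul a b) x = \<pi> a (\<pi> b x)"
      using rep that a(1) unfolding representation_def by blast+
    then show ?thesis
      using a(2)[OF that(1)] representation_zero[OF rep B that(2)] by (simp add: N_def)
  qed
  have "csubspace E" and add: "\<And>x y. x \<in> E \<Longrightarrow> y \<in> E \<Longrightarrow> \<pi> a (x + y) = \<pi> a x + \<pi> a y"
    and sc: "\<And>c x. x \<in> E \<Longrightarrow> \<pi> a (c *\<^sub>C x) = c *\<^sub>C \<pi> a x"
    using rep a(1) unfolding representation_def by blast+
  moreover from this have "\<pi> a 0 = 0"
    using sc[of 0 0] by (simp add: complex_vector.subspace_0)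
  ultimately have "csubspace N"
    by (auto simp: N_def complex_vector.subspace_def)
  moreover have "N \<subseteq> E" by (auto simp: N_def)
  ultimately have "N = {0} \<or> N = E"
    using irr N unfolding irreducible_representation_def by blast
  \<comment> \<open>The action is non-zero, so some \<pi> b x is a non-zero element of
    \<open>N\<close>.\<close>
  moreover have "N \<noteq> {0}"
    using irr N unfolding irreducible_representation_def by blast
  ultimately have "N = E" by blast
  then show ?thesis using a(1) by (auto simp: N_def representation_kernel_def)
qed

lemma representation_kernel_proper:
  "irreducible_representation B mul E \<pi> \<Longrightarrow> representation_kernel B E \<pi> \<noteq> B"
  by (auto simp: irreducible_representation_def representation_kernel_def)

text \<open>Provides the irreducibility of the one-dimensional module on which the algebra acts
  through \<phi>.\<close>

lemma subspace_complex:
  fixes F :: "complex set"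
  assumes "csubspace F"
  shows "F = {0} \<or> F = UNIV"
proof (rule disjCI)
  assume "F \<noteq> UNIV"
  then obtain z where z: "z \<notin> F" by blast
  have "w = 0" if "w \<in> F" for w
  proof (rule ccontr)
    assume "w \<noteq> 0"
    then have "z = (z / w) *\<^sub>C w" by (simp add: scaleC_complex_def)
    then show False using z complex_vector.subspace_scale[OF assms that] by metis
  qed
  then show "F = {0}" using complex_vector.subspace_0[OF assms] by blast
qed

text \<open>Since \<phi>(\<phi>(a)b) = \<phi>(a)\<phi>(b), the functional is a character, and b acts
  on the complex numbers as multiplication by \<phi> b.\<close>

lemma primitive_ideal_functional_kernel:
  assumes \<phi>: "bounded_functional \<phi>" "\<phi> \<noteq> (\<lambda>_. 0)"
  shows "primitive_ideal UNIV (functional_mult \<phi>) {x. \<phi> x = 0}"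
proof -
  have add: "\<phi> (a + b) = \<phi> a + \<phi> b" and sc: "\<phi> (c *\<^sub>C a) = c * \<phi> a" for a b c
    using \<phi>(1) by (auto simp: bounded_functional_def bounded_linear.linear linear_add)
  have "irreducible_representation UNIV (functional_mult \<phi>) (UNIV :: complex set) (\<lambda>b x. \<phi> b * x)"
    unfolding irreducible_representation_def
  proof (intro conjI allI impI)
    show "representation UNIV (functional_mult \<phi>) (UNIV :: complex set) (\<lambda>b x. \<phi> b * x)"
      by (simp add: representation_def functional_mult_def add sc scaleC_complex_def algebra_simps)
    show "\<exists>b\<in>UNIV. \<exists>x\<in>UNIV. \<phi> b * x \<noteq> 0"
      using functional_normalized_vector[OF \<phi>] by (metis UNIV_I mult_1 zero_neq_one)
  qed (use subspace_complex in blast)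
  moreover have "representation_kernel UNIV (UNIV :: complex set) (\<lambda>b x. \<phi> b * x) = {x. \<phi> x = 0}"
    by (auto simp: representation_kernel_def)
  \<comment> \<open>\<open>primitive_ideal\<close> asks for a module inside the type of the algebra,
    so the module of complex numbers has to be transferred there.\<close>
  ultimately show ?thesis
    using irreducible_representation_kernel_primitive[of UNIV "functional_mult \<phi>"] by fastforce
qed

lemma primitive_ideal_functional_mult_iff:
  assumes \<phi>: "bounded_functional \<phi>" "\<phi> \<noteq> (\<lambda>_. 0)"
  shows "primitive_ideal UNIV (functional_mult \<phi>) P \<longleftrightarrow> P = {x. \<phi> x = 0}"
proof
  assume "primitive_ideal UNIV (functional_mult \<phi>) P"
  then obtain E :: "'a set" and \<pi> where
    irr: "irreducible_representation UNIV (functional_mult \<phi>) E \<pi>"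
    and P: "P = representation_kernel UNIV E \<pi>"
    unfolding primitive_ideal_def by blast
  have "{x. \<phi> x = 0} \<subseteq> P"
    using irreducible_representation_left_annihilator[OF irr]
    by (auto simp: P functional_mult_def)
  moreover have "csubspace P"
    unfolding P
  proof (rule subspace_representation_kernel)
    show "representation UNIV (functional_mult \<phi>) E \<pi>"
      using irr by (simp add: irreducible_representation_def)
  qed simp
  \<comment> \<open>By maximality of the hyperplane the only alternative is \<open>P = UNIV\<close>,
    which would make the action zero.\<close>
  ultimately show "P = {x. \<phi> x = 0}"
    using hyperplane_maximal[OF \<phi>(1)] representation_kernel_proper[OF irr] P by blast
qed (simp add: primitive_ideal_functional_kernel[OF \<phi>])

text \<open>Used in contrapositive form for the failure of semi-simplicity. The line through a
  vector u with \<phi> u = 1 contains the trivial kernel properly, so it is the whole space by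
  maximality of the hyperplane.\<close>

lemma functional_kernel_trivial_imp_dim_1:
  fixes \<phi> :: "'a::complex_banach \<Rightarrow> complex"
  assumes \<phi>: "bounded_functional \<phi>" "\<phi> \<noteq> (\<lambda>_. 0)" and ker: "{x. \<phi> x = 0} = {0}"
  shows "complex_vector.dim (UNIV :: 'a set) = 1"
proof -
  obtain u where u: "\<phi> u = 1" using functional_normalized_vector[OF \<phi>] .
  have "{x. \<phi> x = 0} \<subseteq> complex_vector.span {u}"
    unfolding ker by (simp add: complex_vector.span_zero)
  then have "complex_vector.span {u} = UNIV \<or> complex_vector.span {u} = {x. \<phi> x = 0}"
    by (rule hyperplane_maximal[OF \<phi>(1) complex_vector.subspace_span])
  moreover have "u \<in> complex_vector.span {u}" by (simp add: complex_vector.span_base)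
  moreover have "u \<notin> {x. \<phi> x = 0}" using u by simp
  ultimately have span: "complex_vector.span {u} = UNIV" by metis
  have "u \<noteq> 0" using \<open>u \<notin> {x. \<phi> x = 0}\<close> ker by simp
  then have "complex_vector.independent {u}" by simp
  then have "complex_vector.dim (complex_vector.span {u}) = card {u}"
    by (rule complex_vector.dim_span_eq_card_independent)
  then show ?thesis unfolding span by simp
qed

text \<open>An x in \<open>I\<close> outside the kernel generates everything: right multiplication
  by b gives \<phi>(x)b, and dividing by \<phi> x recovers b.\<close>

lemma two_sided_ideal_subset_functional_kernel:
  assumes I: "two_sided_ideal UNIV (functional_mult \<phi>) I" and "I \<noteq> UNIV"
  shows "I \<subseteq> {x. \<phi> x = 0}"
proof (rule ccontr)
  have sub: "csubspace I" and right: "\<And>x b. x \<in> I \<Longrightarrow> \<phi> x *\<^sub>C b \<in> I"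
    using I by (auto simp: two_sided_ideal_def left_ideal_def functional_mult_def)
  assume "\<not> I \<subseteq> {x. \<phi> x = 0}"
  then obtain x where x: "x \<in> I" "\<phi> x \<noteq> 0" by blast
  have "b \<in> I" for b
    using complex_vector.subspace_scale[OF sub right[OF x(1)], of "1 / \<phi> x" b] x(2) by simp
  with \<open>I \<noteq> UNIV\<close> show False by blast
qed

lemma rad_zero_product:
  assumes B: "csubspace B" and "\<And>a b. a \<in> B \<Longrightarrow> b \<in> B \<Longrightarrow> mul a b = 0"
  shows "rad B mul = B"
proof -
  have "\<not> primitive_ideal B mul P" for P
  proof
    assume "primitive_ideal B mul P"
    then obtain E :: "'a set" and \<pi> where irr: "irreducible_representation B mul E \<pi>"
      unfolding primitive_ideal_def by blast
    have "B \<subseteq> representation_kernel B E \<pi>"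
      using irreducible_representation_left_annihilator[OF irr B] assms(2) by blast
    then show False
      using representation_kernel_proper[OF irr] by (auto simp: representation_kernel_def)
  qed
  \<comment> \<open>The intersection of the empty family is \<open>UNIV\<close>; the factor
    \<open>B\<close> in \<open>rad\<close> cuts it down to \<open>B\<close>.\<close>
  then show ?thesis by (simp add: rad_def)
qed

theorem mainTheorem6:
  fixes \<phi> :: "'a::complex_banach \<Rightarrow> complex"
  assumes "bounded_functional \<phi>" and "\<phi> \<noteq> (\<lambda>_. 0)" and "onorm \<phi> \<le> 1"
  shows "(\<forall>I. csubspace I \<longrightarrow>
      (modular_left_ideal UNIV (functional_mult \<phi>) I \<longleftrightarrow> I = UNIV \<or> I = {x. \<phi> x = 0})) \<and>
    (\<forall>P. primitive_ideal UNIV (functional_mult \<phi>) P \<longleftrightarrow> P = {x. \<phi> x = 0}) \<and>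
    rad UNIV (functional_mult \<phi>) = {x. \<phi> x = 0} \<and>
    (complex_vector.dim (UNIV :: 'a set) \<noteq> 1 \<longrightarrow> \<not> semi_simple UNIV (functional_mult \<phi>)) \<and>
    (\<forall>I. two_sided_ideal UNIV (functional_mult \<phi>) I \<and> closed I \<and> I \<noteq> {0} \<and> I \<noteq> UNIV \<longrightarrow>
      rad I (functional_mult \<phi>) = I \<inter> rad UNIV (functional_mult \<phi>) \<and>
      I \<inter> rad UNIV (functional_mult \<phi>) = I \<inter> {x. \<phi> x = 0} \<and>
      I \<inter> {x. \<phi> x = 0} = I)"
proof -
  note \<phi> = assms(1,2)
  have prim: "primitive_ideal UNIV (functional_mult \<phi>) P \<longleftrightarrow> P = {x. \<phi> x = 0}" for P
    by (rule primitive_ideal_functional_mult_iff[OF \<phi>])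
  then have rad: "rad UNIV (functional_mult \<phi>) = {x. \<phi> x = 0}"
    by (simp add: rad_def)
  \<comment> \<open>Once the radical of the whole algebra is known to be the kernel, these two facts
    yield the whole chain of equalities for \<open>I\<close>.\<close>
  have "rad I (functional_mult \<phi>) = I \<and> I \<subseteq> {x. \<phi> x = 0}"
    if I: "two_sided_ideal UNIV (functional_mult \<phi>) I" "I \<noteq> UNIV" for I
  proof
    show sub: "I \<subseteq> {x. \<phi> x = 0}"
      by (rule two_sided_ideal_subset_functional_kernel[OF I])
    show "rad I (functional_mult \<phi>) = I"
    proof (rule rad_zero_product)
      show "csubspace I" using I(1) by (simp add: two_sided_ideal_def left_ideal_def)
    qed (use sub in \<open>auto simp: functional_mult_def\<close>)
  qed
  then show ?thesis
    using modular_left_ideal_functional_mult_iff[OF \<phi>] functional_kernel_trivial_imp_dim_1[OF \<phi>] prim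
    by (simp add: rad semi_simple_def) blast
qed

end
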